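(* Let $n\ge 1$. The map $\theta:\mathcal T(n)\to\mathcal T(n)$ described in the context is well defined and is an involution, and it exchanges the statistics $\deg(0)$ and $\deg(p)$: for every $T\in\mathcal T(n)$, with $p_T$ denoting the parent of vertex $1$ in $T$ and $\deg_T(v)$ the number of children of $v$ in $T$, $$\deg_{\theta(T)}(0)=\deg_T(p_T)\quad\text{and}\quad \deg_{\theta(T)}(p_{\theta(T)})=\deg_T(0).$$ Moreover $\deg_{\theta(T)}(v)=\deg_T(v)$ for all vertices $v\notin\{0,p_T\}$. In particular, $\deg(0)$ and $\deg(p)$ are equidistributed on $\mathcal T(n)$.
   Context: $\mathcal T(n)$ is the set of trees on the vertex set $\{0,1,\dots,n\}$, rooted at $0$. The map $\theta$: given $T\in\mathcal T(n)$, let $p$ be the parent of vertex $1$ in $T$. (1) Remove the edge connecting $1$ and $p$; (2) connect $0$ and $1$ by an edge; (3) interchange the labels of the vertices $0$ and $p$. The resulting labeled tree, rooted at (the new) vertex $0$, is $\theta(T)$. If $p=0$ then $\theta(T)=T$. *)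

theory Defs
  imports Main "HOL-Combinatorics.Transposition"
begin

text \<open>
  A finite simple graph with a given vertex set is represented by its set of edges, an edge
  being the two-element set of its endpoints.
\<close>

definition simple_graph :: "'a set \<Rightarrow> 'a set set \<Rightarrow> bool" where
  "simple_graph V E \<longleftrightarrow> finite V \<and> E \<subseteq> {e. e \<subseteq> V \<and> card e = 2}"

definition path :: "'a set set \<Rightarrow> 'a list \<Rightarrow> bool" where
  "path E xs \<longleftrightarrow> xs \<noteq> [] \<and> distinct xs \<and> successively (\<lambda>u v. {u, v} \<in> E) xs"

definition cycle :: "'a set set \<Rightarrow> 'a list \<Rightarrow> bool" where
  "cycle E xs \<longleftrightarrow> length xs \<ge> 3 \<and> path E xs \<and> {last xs, hd xs} \<in> E"

definition connected_graph :: "'a set \<Rightarrow> 'a set set \<Rightarrow> bool" where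
  "connected_graph V E \<longleftrightarrow>
     V \<noteq> {} \<and> (\<forall>u\<in>V. \<forall>v\<in>V. \<exists>xs. path E xs \<and> hd xs = u \<and> last xs = v)"

definition tree :: "'a set \<Rightarrow> 'a set set \<Rightarrow> bool" where
  "tree V E \<longleftrightarrow> simple_graph V E \<and> connected_graph V E \<and> (\<nexists>xs. cycle E xs)"

definition trees :: "nat \<Rightarrow> nat set set set" where
  "trees n = {T. tree {0..n} T}"

text \<open>
  All trees on natural numbers are rooted at \<open>0\<close>: \<open>u\<close> is a parent of \<open>v\<close> if it is the vertex
  immediately before \<open>v\<close> on a path from the root to \<open>v\<close>.
\<close>

definition is_parent :: "nat set set \<Rightarrow> nat \<Rightarrow> nat \<Rightarrow> bool" where
  "is_parent T u v \<longleftrightarrow> (\<exists>xs. path T (xs @ [u, v]) \<and> hd (xs @ [u, v]) = 0)"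

definition parent :: "nat set set \<Rightarrow> nat \<Rightarrow> nat" where
  "parent T v = (THE u. is_parent T u v)"

definition children :: "nat set set \<Rightarrow> nat \<Rightarrow> nat set" where
  "children T v = {w. is_parent T v w}"

definition deg :: "nat set set \<Rightarrow> nat \<Rightarrow> nat" where
  "deg T v = card (children T v)"

definition relabel :: "('a \<Rightarrow> 'b) \<Rightarrow> 'a set set \<Rightarrow> 'b set set" where
  "relabel f E = (\<lambda>e. f ` e) ` E"

definition theta :: "nat set set \<Rightarrow> nat set set" where
  "theta T =
     (let p = parent T 1
      in if p = 0 then T
         else relabel (transpose 0 p) (insert {0, 1} (T - {{1, p}})))"

lemma finite_trees: "finite (trees n)"
  by (rule finite_subset[of _ "Pow (Pow {0..n})"])
    (auto simp: trees_def tree_def simple_graph_def)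

end

theory Submission imports Defs begin

text \<open>
  Deleting the edge \<open>{1, p}\<close> of a tree \<open>T\<close> splits it into two components. Since \<open>p\<close> is the parent of
  \<open>1\<close>, the component that does not contain \<open>1\<close> contains both \<open>0\<close> and \<open>p\<close>, so that joining \<open>1\<close> to
  \<open>0\<close> instead of \<open>p\<close> again gives a tree (\<open>tree_exchange\<close>), and so does the relabelling of this tree
  (\<open>tree_relabel\<close>). Write \<open>T\<close> as the disjoint union of \<open>F\<close> and \<open>{{1, p}}\<close>; then \<open>\<theta>(T)\<close> consists of
  the edge \<open>{1, p}\<close> and of \<open>F\<close> with \<open>0\<close> and \<open>p\<close> interchanged. In that form it is plain that \<open>p\<close> is
  again the parent of \<open>1\<close> and that \<open>\<theta>\<close> is an involution.

  For the degrees, count neighbours rather than children: a vertex has one neighbour more than it has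
  children, except that the root has equally many (\<open>deg_root\<close>, \<open>deg_nonroot\<close>). Moving the edge takes
  one neighbour from \<open>p\<close> and gives one to \<open>0\<close>. After the interchange of the labels this change by one
  is exactly the difference between root and non-root vertices, so the numbers of children are
  interchanged.

  The arguments about trees use walks, that is, the reflexive transitive closure of adjacency, instead
  of paths. A graph is acyclic if and only if each of its edges is a bridge (\<open>acyclic_iff_bridges\<close>),
  and in a tree \<open>u\<close> is the parent of \<open>v\<close> if and only if \<open>{u, v}\<close> is an edge whose deletion
  leaves \<open>u\<close> on the side of the root (\<open>is_parent_iff\<close>).
\<close>

section \<open>Walks and paths\<close>

definition adj :: "'a set set \<Rightarrow> ('a \<times> 'a) set" where
  "adj E = {(u, v). {u, v} \<in> E}"

abbreviation reach :: "'a set set \<Rightarrow> 'a \<Rightarrow> 'a \<Rightarrow> bool" where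
  "reach E u v \<equiv> (u, v) \<in> (adj E)\<^sup>*"

lemma reach_sym: "reach E u v \<Longrightarrow> reach E v u"
proof -
  have "sym (adj E)" by (auto simp: sym_def adj_def insert_commute)
  then show "reach E u v \<Longrightarrow> reach E v u" by (meson sym_rtrancl symD)
qed

lemma reach_mono: "reach E u v \<Longrightarrow> E \<subseteq> F \<Longrightarrow> reach F u v"
  by (rule subsetD[OF rtrancl_mono]) (auto simp: adj_def)

lemma reach_edge: "{u, v} \<in> E \<Longrightarrow> reach E u v"
  by (auto simp: adj_def)

lemma path_mono: "path E xs \<Longrightarrow> E \<subseteq> F \<Longrightarrow> path F xs"
  unfolding path_def by (auto elim!: successively_mono)

lemma path_appendD1: "path E (xs @ ys) \<Longrightarrow> xs \<noteq> [] \<Longrightarrow> path E xs"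
  by (auto simp: path_def successively_append_iff)

lemma path_appendD2: "path E (xs @ ys) \<Longrightarrow> ys \<noteq> [] \<Longrightarrow> path E ys"
  by (auto simp: path_def successively_append_iff)

lemma path_snoc:
  "path E xs \<Longrightarrow> {last xs, v} \<in> E \<Longrightarrow> v \<notin> set xs \<Longrightarrow> path E (xs @ [v])"
  by (auto simp: path_def successively_append_iff)

lemma path_imp_reach: "path E xs \<Longrightarrow> reach E (hd xs) (last xs)"
proof (induction xs rule: rev_induct)
  case (snoc x xs)
  show ?case
  proof (cases "xs = []")
    case False
    then have "reach E (hd xs) (last xs)"
      using snoc path_appendD1 by blast
    moreover have "{last xs, x} \<in> E"
      using snoc.prems False by (auto simp: path_def successively_append_iff)
    ultimately show ?thesis
      using False by (auto intro: rtrancl_into_rtrancl simp: adj_def)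
  qed simp
qed (simp add: path_def)

lemma reach_imp_path:
  assumes "reach E u v"
  shows "\<exists>xs. path E xs \<and> hd xs = u \<and> last xs = v"
  using assms
proof (induction rule: rtrancl_induct)
  case base
  have "path E [u]" by (simp add: path_def)
  then show ?case by force
next
  case (step v w)
  then obtain xs where xs: "path E xs" "hd xs = u" "last xs = v" by blast
  have ne: "xs \<noteq> []" using xs(1) by (simp add: path_def)
  show ?case
  proof (cases "w \<in> set xs")
    case True
    \<comment> \<open>The walk has returned to the path; the detour is cut off.\<close>
    then obtain as bs where s: "xs = as @ w # bs" by (auto dest: split_list)
    then have "path E (as @ [w])" using xs(1) path_appendD1[of E "as @ [w]" bs] by simp
    moreover have "hd (as @ [w]) = u" using s xs(2) by (cases as) auto
    ultimately show ?thesis by force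
  next
    case False
    have "path E (xs @ [w])"
      using xs False step.hyps(2) by (intro path_snoc) (auto simp: adj_def)
    then show ?thesis using xs(2) ne by (intro exI[of _ "xs @ [w]"]) simp
  qed
qed

lemma connected_graph_iff_reach:
  "connected_graph V E \<longleftrightarrow> V \<noteq> {} \<and> (\<forall>u\<in>V. \<forall>v\<in>V. reach E u v)"
  unfolding connected_graph_def using path_imp_reach reach_imp_path by metis

text \<open>A walk can be shortened so that it crosses the new edge at most once.\<close>

lemma reach_insert_cases:
  assumes "reach (insert {a, c} F) u v"
  shows "reach F u v \<or> reach F u a \<and> reach F c v \<or> reach F u c \<and> reach F a v"
  using assms
proof (induction rule: rtrancl_induct)
  case (step v w)
  have "reach F v w \<or> (v = a \<and> w = c) \<or> (v = c \<and> w = a)"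
    using step.hyps(2) by (auto simp: adj_def doubleton_eq_iff)
  then show ?case
    using step.IH by (meson rtrancl.rtrancl_refl rtrancl_trans)
qed simp

section \<open>Bridges and exchange of edges\<close>

definition all_bridges :: "'a set set \<Rightarrow> bool" where
  "all_bridges E \<longleftrightarrow> (\<forall>u v. {u, v} \<in> E \<longrightarrow> \<not> reach (E - {{u, v}}) u v)"

text \<open>A cycle through \<open>{u, v}\<close> is this edge together with a path that joins its ends without using it.\<close>

lemma acyclic_iff_bridges:
  assumes "simple_graph V E"
  shows "(\<nexists>xs. cycle E xs) \<longleftrightarrow> all_bridges E"
proof
  assume acyc: "\<nexists>xs. cycle E xs"
  show "all_bridges E"
    unfolding all_bridges_def
  proof (intro allI impI notI)
    fix u v assume e: "{u, v} \<in> E" and r: "reach (E - {{u, v}}) u v"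
    then obtain xs where xs: "path (E - {{u, v}}) xs" "hd xs = u" "last xs = v"
      using reach_imp_path by metis
    have "card {u, v} = 2" using assms e by (auto simp: simple_graph_def)
    then have "u \<noteq> v" by auto
    have "length xs \<ge> 3"
    proof (rule ccontr)
      assume "\<not> length xs \<ge> 3"
      then consider "xs = []" | x where "xs = [x]" | x y where "xs = [x, y]"
        by (cases xs rule: remdups_adj.cases) (auto simp: Suc_le_eq)
      then show False using xs \<open>u \<noteq> v\<close> by cases (auto simp: path_def)
    qed
    moreover have "path E xs" using xs(1) by (rule path_mono) auto
    ultimately have "cycle E xs" using xs e by (simp add: cycle_def insert_commute)
    then show False using acyc by blast
  qed
next
  assume br: "all_bridges E"
  show "\<nexists>xs. cycle E xs"
  proof
    assume "\<exists>xs. cycle E xs"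
    then obtain xs where len: "length xs \<ge> 3" and p: "path E xs" and e: "{last xs, hd xs} \<in> E"
      by (auto simp: cycle_def)
    let ?e = "{hd xs, last xs}"
    have hl: "hd xs = xs ! 0" "last xs = xs ! (length xs - 1)"
      using len by (auto simp: hd_conv_nth last_conv_nth simp flip: length_greater_0_conv)
    have d: "distinct xs" using p by (simp add: path_def)
    have "{xs ! i, xs ! Suc i} \<noteq> ?e" if "Suc i < length xs" for i
    proof
      assume eq: "{xs ! i, xs ! Suc i} = ?e"
      have idx: "xs ! j = xs ! k \<longleftrightarrow> j = k" if "j < length xs" "k < length xs" for j k
        using d that by (rule nth_eq_iff_index_eq)
      have "0 < length xs" "length xs - 1 < length xs" using len by linarith+
      then have "(i = 0 \<and> Suc i = length xs - 1) \<or> (i = length xs - 1 \<and> Suc i = 0)"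
        using eq that unfolding hl doubleton_eq_iff by (metis idx Suc_lessD)
      then show False
        using len by linarith
    qed
    then have "path (E - {?e}) xs"
      using p by (auto simp: path_def successively_conv_nth)
    then have "reach (E - {?e}) (hd xs) (last xs)" by (rule path_imp_reach)
    moreover have "?e \<in> E" using e by (simp add: insert_commute)
    ultimately show False using br by (auto simp: all_bridges_def)
  qed
qed

lemma tree_iff_bridges:
  "tree V E \<longleftrightarrow> simple_graph V E \<and> V \<noteq> {} \<and> (\<forall>u\<in>V. \<forall>v\<in>V. reach E u v) \<and> all_bridges E"
  unfolding tree_def connected_graph_iff_reach using acyclic_iff_bridges by blast

lemma tree_bridge: "tree V E \<Longrightarrow> {u, v} \<in> E \<Longrightarrow> \<not> reach (E - {{u, v}}) u v"
  by (auto simp: tree_iff_bridges all_bridges_def)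

lemma tree_edge: "tree V E \<Longrightarrow> {u, v} \<in> E \<Longrightarrow> u \<in> V \<and> v \<in> V \<and> u \<noteq> v"
  by (auto simp: tree_def simple_graph_def)

text \<open>
  The end \<open>b\<close> of a bridge may be replaced by any vertex \<open>c\<close> on its own side. If another edge
  \<open>{x, y}\<close> lay on a cycle of the new tree, then either that cycle avoids \<open>{a, c}\<close> and existed before,
  or it leads from \<open>a\<close> through \<open>{x, y}\<close> to \<open>c\<close> and on to \<open>b\<close>, around the bridge \<open>{a, b}\<close>.
\<close>

lemma tree_exchange:
  assumes T: "tree V T" and ab: "{a, b} \<in> T" and c: "c \<in> V"
    and bc: "reach (T - {{a, b}}) c b"
  shows "tree V (insert {a, c} (T - {{a, b}}))"
proof -
  let ?F = "T - {{a, b}}"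
  let ?M = "insert {a, c} ?F"
  have nab: "\<not> reach ?F a b" using tree_bridge[OF T ab] .
  then have nac: "\<not> reach ?F a c" using bc by (meson rtrancl_trans)
  then have "a \<noteq> c" by auto
  have s: "simple_graph V ?M"
    using T c \<open>a \<noteq> c\<close> tree_edge[OF T ab] by (auto simp: tree_def simple_graph_def)
  have step: "reach ?M u v" if "(u, v) \<in> adj T" for u v
  proof (cases "{u, v} = {a, b}")
    case True
    have "reach ?M a c" by (rule reach_edge) simp
    also have "reach ?M c b" using bc by (rule reach_mono) auto
    finally have "reach ?M a b" .
    then show ?thesis using True reach_sym by (auto simp: doubleton_eq_iff)
  next
    case False
    then show ?thesis using that by (intro reach_edge) (auto simp: adj_def)
  qed
  have "(adj T)\<^sup>* \<subseteq> (adj ?M)\<^sup>*"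
    by (rule rtrancl_subset_rtrancl) (use step in auto)
  then have con: "\<forall>u\<in>V. \<forall>v\<in>V. reach ?M u v" using T by (auto simp: tree_iff_bridges)
  have "\<not> reach (?M - {{x, y}}) x y" if xy: "{x, y} \<in> ?M" for x y
  proof
    assume r: "reach (?M - {{x, y}}) x y"
    show False
    proof (cases "{x, y} = {a, c}")
      case True
      then have "reach ?F x y" by (intro reach_mono[OF r]) auto
      then show False using True nac reach_sym by (fastforce simp: doubleton_eq_iff)
    next
      case False
      let ?G = "?F - {{x, y}}"
      have xyF: "{x, y} \<in> ?F" using xy False by auto
      have "?M - {{x, y}} = insert {a, c} ?G" using False by auto
      then consider "reach ?G x y" | "reach ?G x a" "reach ?G c y" | "reach ?G x c" "reach ?G a y"
        using r reach_insert_cases by metis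
      then show False
      proof cases
        case 1
        then have "reach (T - {{x, y}}) x y" by (rule reach_mono) auto
        then show False using tree_bridge[OF T] xyF by blast
      next
        case 2
        have G: "?G \<subseteq> ?F" by auto
        have "reach ?F a x" "reach ?F y c"
          using 2 G reach_mono reach_sym by metis+
        then show False using nac reach_edge[OF xyF] by (meson rtrancl_trans)
      next
        case 3
        have G: "?G \<subseteq> ?F" by auto
        have "reach ?F a y" "reach ?F x c"
          using 3 G reach_mono by metis+
        then show False using nac reach_sym[OF reach_edge[OF xyF]] by (meson rtrancl_trans)
      qed
    qed
  qed
  then show ?thesis using s con c unfolding tree_iff_bridges all_bridges_def by blast
qed

section \<open>Relabelling\<close>

lemma relabel_edge_iff:
  assumes "inj f"
  shows "{f u, f v} \<in> relabel f E \<longleftrightarrow> {u, v} \<in> E"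
proof -
  have "f ` {u, v} \<in> relabel f E \<longleftrightarrow> {u, v} \<in> E"
    unfolding relabel_def image_iff inj_image_eq_iff[OF assms] by simp
  then show ?thesis by simp
qed

lemma path_relabel_iff:
  assumes "inj f"
  shows "path (relabel f E) (map f xs) \<longleftrightarrow> path E xs"
  using assms
  by (auto simp: path_def successively_map relabel_edge_iff distinct_map intro: inj_on_subset)

lemma reach_relabel:
  assumes "inj f" "reach E u v"
  shows "reach (relabel f E) (f u) (f v)"
  using assms(2)
proof (induction rule: rtrancl_induct)
  case (step v w)
  have "(f v, f w) \<in> adj (relabel f E)"
    using step.hyps(2) relabel_edge_iff[OF assms(1)] by (auto simp: adj_def)
  then show ?case using step.IH by (rule rtrancl_into_rtrancl[rotated])
qed simp

lemma tree_relabel: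
  assumes f: "bij f" and T: "tree V T"
  shows "tree (f ` V) (relabel f T)"
proof -
  have i: "inj f" and sf: "surj f" using f by (auto simp: bij_def)
  have s: "simple_graph (f ` V) (relabel f T)"
    using T i by (auto simp: tree_def simple_graph_def relabel_def card_image inj_on_subset)
  have c: "\<forall>u\<in>f ` V. \<forall>v\<in>f ` V. reach (relabel f T) u v"
    using T reach_relabel[OF i] by (auto simp: tree_iff_bridges)
  have "\<not> cycle (relabel f T) ys" for ys
  proof
    assume y: "cycle (relabel f T) ys"
    obtain xs where xs: "ys = map f xs" using sf by (metis ex_map_conv surjD)
    have "xs \<noteq> []" using y xs by (auto simp: cycle_def)
    then have "cycle T xs"
      using y xs relabel_edge_iff[OF i] path_relabel_iff[OF i]
      by (auto simp: cycle_def hd_map last_map)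
    then show False using T by (auto simp: tree_def)
  qed
  then show ?thesis
    using s c T unfolding tree_def connected_graph_iff_reach by auto
qed

section \<open>Parents and degrees in a rooted tree\<close>

lemma is_parentD:
  assumes "is_parent T u v"
  shows "{u, v} \<in> T" "reach {e \<in> T. v \<notin> e} 0 u"
proof -
  obtain xs where p: "path T (xs @ [u, v])" and h: "hd (xs @ [u, v]) = 0"
    using assms by (auto simp: is_parent_def)
  show "{u, v} \<in> T" using p by (auto simp: path_def successively_append_iff)
  have q: "path T (xs @ [u])" using p path_appendD1[of T "xs @ [u]" "[v]"] by simp
  have v: "v \<notin> set (xs @ [u])" using p by (auto simp: path_def)
  have "successively (\<lambda>a b. {a, b} \<in> {e \<in> T. v \<notin> e}) (xs @ [u])"
    by (rule successively_mono[of "\<lambda>a b. {a, b} \<in> T"]) (use q v in \<open>auto simp: path_def\<close>)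
  then have "path {e \<in> T. v \<notin> e} (xs @ [u])" using q by (simp add: path_def)
  then have "reach {e \<in> T. v \<notin> e} (hd (xs @ [u])) u"
    using path_imp_reach[of _ "xs @ [u]"] by simp
  moreover have "hd (xs @ [u]) = 0" using h by (cases xs) auto
  ultimately show "reach {e \<in> T. v \<notin> e} 0 u" by simp
qed

text \<open>
  A path from the root to \<open>u\<close> that avoids the edge \<open>{u, v}\<close> also avoids the vertex \<open>v\<close>, since
  \<open>{u, v}\<close> is a bridge. It can therefore be prolonged by \<open>v\<close>.
\<close>

lemma is_parent_iff:
  assumes T: "tree V T"
  shows "is_parent T u v \<longleftrightarrow> {u, v} \<in> T \<and> reach (T - {{u, v}}) 0 u"
proof
  assume p: "is_parent T u v"
  have "reach (T - {{u, v}}) 0 u"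
    using is_parentD(2)[OF p] by (rule reach_mono) auto
  then show "{u, v} \<in> T \<and> reach (T - {{u, v}}) 0 u" using is_parentD(1)[OF p] by simp
next
  assume a: "{u, v} \<in> T \<and> reach (T - {{u, v}}) 0 u"
  then obtain xs where xs: "path (T - {{u, v}}) xs" "hd xs = 0" "last xs = u"
    using reach_imp_path by metis
  have ne: "xs \<noteq> []" using xs(1) by (simp add: path_def)
  have "v \<notin> set xs"
  proof
    assume "v \<in> set xs"
    then obtain as bs where s: "xs = as @ v # bs" by (auto dest: split_list)
    then have "path (T - {{u, v}}) (v # bs)" using xs(1) path_appendD2 by blast
    then have "reach (T - {{u, v}}) v u" using path_imp_reach[of _ "v # bs"] xs(3) s by simp
    then have "reach (T - {{u, v}}) u v" by (rule reach_sym)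
    then show False using tree_bridge[OF T] a by simp
  qed
  moreover have "path T xs" using xs(1) by (rule path_mono) auto
  ultimately have "path T (xs @ [v])" using xs a by (intro path_snoc) auto
  moreover have "xs @ [v] = butlast xs @ [u, v]"
    using ne xs(3) append_butlast_last_id[of xs] by (metis append.assoc append_Cons append_Nil)
  moreover have "hd (xs @ [v]) = 0" using ne xs(2) by simp
  ultimately show "is_parent T u v" unfolding is_parent_def by metis
qed

text \<open>
  If \<open>v\<close> had two parents, then the paths from them to the root, both of which avoid \<open>v\<close>, would
  join one parent to \<open>v\<close> by way of the other, around the bridge between that parent and \<open>v\<close>.
\<close>

lemma ex1_parent:
  assumes T: "tree V T" and "0 \<in> V" "v \<in> V" "v \<noteq> 0"
  shows "\<exists>!u. is_parent T u v"
proof (rule ex_ex1I)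
  obtain xs where xs: "path T xs" "hd xs = 0" "last xs = v"
    using T assms unfolding tree_def connected_graph_def by blast
  have ne: "xs \<noteq> []" using xs(1) by (simp add: path_def)
  have "butlast xs \<noteq> []"
    using xs ne \<open>v \<noteq> 0\<close> by (metis append_Nil append_butlast_last_id list.sel(1))
  then have "xs = butlast (butlast xs) @ [last (butlast xs), v]"
    using ne xs(3) by (metis append.assoc append_Cons append_Nil append_butlast_last_id)
  then show "\<exists>u. is_parent T u v" using xs(1,2) unfolding is_parent_def by metis
next
  fix u u' assume p: "is_parent T u v" "is_parent T u' v"
  show "u = u'"
  proof (rule ccontr)
    assume "u \<noteq> u'"
    let ?F = "T - {{u, v}}"
    have "reach ?F 0 u" using is_parentD(2)[OF p(1)] by (rule reach_mono) auto
    then have "reach ?F u 0" by (rule reach_sym)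
    also have "reach ?F 0 u'" using is_parentD(2)[OF p(2)] by (rule reach_mono) auto
    also have "reach ?F u' v"
      using is_parentD(1)[OF p(2)] \<open>u \<noteq> u'\<close> by (intro reach_edge) (auto simp: doubleton_eq_iff)
    finally show False using tree_bridge[OF T is_parentD(1)[OF p(1)]] by simp
  qed
qed

lemma is_parent_parent:
  assumes "tree V T" "0 \<in> V" "v \<in> V" "v \<noteq> 0"
  shows "is_parent T (parent T v) v"
  unfolding parent_def using ex1_parent[OF assms] by (rule theI')

lemma parent_eqI:
  assumes "tree V T" "0 \<in> V" "v \<in> V" "v \<noteq> 0" "is_parent T u v"
  shows "parent T v = u"
  using ex1_parent[OF assms(1-4)] is_parent_parent[OF assms(1-4)] assms(5) by blast

definition nbrs :: "'a set set \<Rightarrow> 'a \<Rightarrow> 'a set" where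
  "nbrs E v = {w. {v, w} \<in> E}"

lemma finite_nbrs: "tree V T \<Longrightarrow> finite (nbrs T v)"
  by (rule finite_subset[of _ V]) (auto simp: nbrs_def dest: tree_edge simp: tree_def simple_graph_def)

lemma nbrs_relabel:
  assumes "bij f"
  shows "nbrs (relabel f E) (f v) = f ` nbrs E v"
proof -
  have i: "inj f" and s: "surj f" using assms by (auto simp: bij_def)
  show ?thesis
  proof (intro set_eqI)
    fix y
    obtain w where "y = f w" using s by blast
    then show "y \<in> nbrs (relabel f E) (f v) \<longleftrightarrow> y \<in> f ` nbrs E v"
      using i by (simp add: nbrs_def relabel_edge_iff inj_image_mem_iff)
  qed
qed

lemma card_nbrs_relabel:
  assumes "bij f"
  shows "card (nbrs (relabel f E) (f v)) = card (nbrs E v)"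
  unfolding nbrs_relabel[OF assms]
  using assms by (intro card_image) (auto simp: bij_def intro: inj_on_subset)

text \<open>Every edge is a bridge, and the root lies on exactly one side of it.\<close>

lemma children_eq:
  assumes T: "tree V T" and "0 \<in> V"
  shows "children T v = {w \<in> nbrs T v. \<not> is_parent T w v}"
proof -
  have "is_parent T v w \<longleftrightarrow> \<not> is_parent T w v" if e: "{v, w} \<in> T" for w
  proof -
    let ?F = "T - {{v, w}}"
    have "v \<in> V" using tree_edge[OF T e] by simp
    then have "reach T 0 v" using T \<open>0 \<in> V\<close> by (auto simp: tree_iff_bridges)
    moreover have "insert {v, w} ?F = T" using e by auto
    ultimately have "reach ?F 0 v \<or> reach ?F 0 w"
      using reach_insert_cases[where a = v and c = w and F = ?F and u = 0 and v = v] by auto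
    moreover have "\<not> (reach ?F 0 v \<and> reach ?F 0 w)"
      using tree_bridge[OF T e] reach_sym by (metis rtrancl_trans)
    ultimately show ?thesis
      using e by (auto simp: is_parent_iff[OF T] insert_commute)
  qed
  then show ?thesis
    by (auto simp: children_def nbrs_def dest: is_parentD(1))
qed

lemma deg_root:
  assumes T: "tree V T" and "0 \<in> V"
  shows "deg T 0 = card (nbrs T 0)"
proof -
  have "\<not> is_parent T w 0" for w
  proof
    assume "is_parent T w 0"
    then have "{w, 0} \<in> T" "reach (T - {{w, 0}}) w 0"
      using is_parent_iff[OF T] reach_sym by auto
    then show False using tree_bridge[OF T] by simp
  qed
  then show ?thesis by (simp add: deg_def children_eq[OF assms])
qed

lemma deg_nonroot:
  assumes T: "tree V T" and V: "0 \<in> V" "v \<in> V" "v \<noteq> 0"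
  shows "card (nbrs T v) = Suc (deg T v)"
proof -
  let ?u = "parent T v"
  have u: "is_parent T ?u v" using is_parent_parent[OF assms] .
  have "is_parent T w v \<longleftrightarrow> w = ?u" for w
    using u parent_eqI[OF assms] by blast
  then have "children T v = nbrs T v - {?u}"
    unfolding children_eq[OF T V(1)] by auto
  moreover have "?u \<in> nbrs T v" using is_parentD(1)[OF u] by (simp add: nbrs_def insert_commute)
  ultimately show ?thesis
    using card_Suc_Diff1[OF finite_nbrs[OF T], of ?u v] by (simp only: deg_def)
qed

section \<open>The involution\<close>

lemma relabel_insert: "relabel f (insert {u, v} E) = insert {f u, f v} (relabel f E)"
  by (simp add: relabel_def)

lemma relabel_transpose_twice: "relabel (transpose a b) (relabel (transpose a b) E) = E"
  by (simp add: relabel_def image_image)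

text \<open>
  Deleting \<open>{1, p}\<close> and adding \<open>{0, 1}\<close> before the relabelling leaves the edge \<open>{1, p}\<close> in place and
  relabels only the rest \<open>F\<close> of the tree. Neither \<open>F\<close> nor its relabelling contains \<open>{1, p}\<close>, and this
  makes the description symmetric in \<open>T\<close> and \<open>\<theta>(T)\<close>.
\<close>

lemma theta_properties:
  assumes n: "n \<ge> 1" and "T \<in> trees n" and p: "p = parent T 1"
  shows "theta T \<in> trees n" "parent (theta T) 1 = p" "theta (theta T) = T"
    "deg (theta T) 0 = deg T p" "deg (theta T) p = deg T 0"
    "\<And>v. v \<in> {0..n} - {0, p} \<Longrightarrow> deg (theta T) v = deg T v"
proof -
  let ?V = "{0..n}"
  have T: "tree ?V T" using assms by (simp add: trees_def)
  have V: "0 \<in> ?V" "1 \<in> ?V" "(1::nat) \<noteq> 0" using n by auto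
  have par: "is_parent T p 1" unfolding p using is_parent_parent[OF T V] .
  have "theta T \<in> trees n \<and> parent (theta T) 1 = p \<and> theta (theta T) = T
    \<and> deg (theta T) 0 = deg T p \<and> deg (theta T) p = deg T 0
    \<and> (\<forall>v \<in> ?V - {0, p}. deg (theta T) v = deg T v)"
  proof (cases "p = 0")
    case True
    then have "theta T = T" using p by (simp add: theta_def)
    then show ?thesis using True p assms(2) by simp
  next
    case False
    define t where "t = transpose 0 p"
    define F where "F = T - {{1, p}}"
    define M where "M = insert {1, 0} F"
    have p1T: "{1, p} \<in> T" using is_parentD(1)[OF par] by (simp add: insert_commute)
    have pV: "p \<in> ?V" "p \<noteq> 1" using tree_edge[OF T p1T] by auto
    have t: "bij t" "inj t" by (auto simp: t_def bij_is_inj)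
    have tv: "t 0 = p" "t p = 0" "t 1 = 1" using False pV by (auto simp: t_def)
    have tV: "t ` ?V = ?V" using pV V by (simp add: t_def)
    have T_eq: "T = insert {1, p} F" using p1T by (auto simp: F_def)
    have F0p: "reach F 0 p"
      using is_parent_iff[OF T] par by (auto simp: F_def insert_commute)
    have n10: "{1, 0} \<notin> T"
    proof
      assume "{1, 0} \<in> T"
      then have "is_parent T 0 1" by (simp add: is_parent_iff[OF T] insert_commute)
      then show False using parent_eqI[OF T V] p False by simp
    qed
    then have n10F: "{1, 0} \<notin> F" by (simp add: F_def)
    have M: "tree ?V M"
      unfolding M_def F_def using tree_exchange[OF T p1T V(1)] F0p by (simp add: F_def)
    have th: "theta T = relabel t M"
      using False unfolding theta_def p[symmetric] Let_def
      by (simp add: t_def M_def F_def insert_commute)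
    have th': "theta T = insert {1, p} (relabel t F)"
      unfolding th M_def relabel_insert using tv by simp
    have S: "tree ?V (theta T)" using tree_relabel[OF t(1) M] th tV by simp
    have n1p: "{1, p} \<notin> relabel t F"
      using n10F relabel_edge_iff[OF t(2), of 1 0 F] tv by simp
    have rest: "theta T - {{1, p}} = relabel t F" using th' n1p by auto
    have "is_parent (theta T) p 1"
    proof -
      have "reach (relabel t F) 0 p"
        using reach_relabel[OF t(2) F0p] tv reach_sym by auto
      moreover have "{1, p} \<in> theta T" using th' by simp
      ultimately show ?thesis
        using rest by (simp add: is_parent_iff[OF S] insert_commute)
    qed
    then have parS: "parent (theta T) 1 = p" using parent_eqI[OF S V] by simp
    have "theta (theta T) = relabel t (insert {1, 0} (theta T - {{1, p}}))"
      using False unfolding theta_def[of "theta T"] parS Let_def by (simp add: t_def insert_commute)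
    also have "\<dots> = T"
      unfolding rest relabel_insert using tv T_eq by (simp add: t_def relabel_transpose_twice)
    finally have inv: "theta (theta T) = T" .
    have cS: "card (nbrs (theta T) (t v)) = card (nbrs M v)" for v
      unfolding th using card_nbrs_relabel[OF t(1)] .
    have fin: "finite (nbrs T v)" for v using finite_nbrs[OF T] .

    have "nbrs M p = nbrs T p - {1}"
      using False pV by (auto simp: nbrs_def M_def F_def doubleton_eq_iff)
    moreover have "1 \<in> nbrs T p" using p1T by (simp add: nbrs_def insert_commute)
    ultimately have "Suc (card (nbrs M p)) = card (nbrs T p)"
      using card_Suc_Diff1 fin by metis
    then have d0: "deg (theta T) 0 = deg T p"
      using deg_root[OF S V(1)] cS[of p] tv deg_nonroot[OF T V(1) pV(1) False] by simp

    have "nbrs M 0 = insert 1 (nbrs T 0)"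
      using False by (auto simp: nbrs_def M_def F_def doubleton_eq_iff)
    moreover have "1 \<notin> nbrs T 0" using n10 by (simp add: nbrs_def insert_commute)
    ultimately have "card (nbrs M 0) = Suc (card (nbrs T 0))" using fin by simp
    then have dp: "deg (theta T) p = deg T 0"
      using deg_root[OF T V(1)] cS[of 0] tv deg_nonroot[OF S V(1) pV(1) False] by simp

    have dv: "deg (theta T) v = deg T v" if v: "v \<in> ?V - {0, p}" for v
    proof -
      have "card (nbrs M v) = card (nbrs T v)"
      proof (cases "v = 1")
        case True
        have "nbrs M 1 = insert 0 (nbrs T 1 - {p})"
          using pV by (auto simp: nbrs_def M_def F_def doubleton_eq_iff)
        moreover have "0 \<notin> nbrs T 1" "p \<in> nbrs T 1" using n10 p1T by (auto simp: nbrs_def)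
        ultimately show ?thesis using fin True card_Suc_Diff1[of "nbrs T 1" p] by simp
      next
        case False
        then have "nbrs M v = nbrs T v"
          using v by (auto simp: nbrs_def M_def F_def doubleton_eq_iff)
        then show ?thesis by simp
      qed
      moreover have "t v = v" using v by (simp add: t_def)
      ultimately have "card (nbrs (theta T) v) = card (nbrs T v)" using cS[of v] by simp
      then show ?thesis using deg_nonroot[OF S V(1), of v] deg_nonroot[OF T V(1), of v] v by simp
    qed
    show ?thesis using S parS inv d0 dp dv by (simp add: trees_def)
  qed
  then show "theta T \<in> trees n" "parent (theta T) 1 = p" "theta (theta T) = T"
    "deg (theta T) 0 = deg T p" "deg (theta T) p = deg T 0"
    "\<And>v. v \<in> {0..n} - {0, p} \<Longrightarrow> deg (theta T) v = deg T v"
    by blast+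
qed

theorem mainTheorem6:
  fixes n :: nat
  assumes "n \<ge> 1"
  shows "(\<forall>T \<in> trees n. (\<exists>!p. is_parent T p 1) \<and> theta T \<in> trees n)
    \<and> (\<forall>T \<in> trees n. theta (theta T) = T)
    \<and> (\<forall>T \<in> trees n.
          deg (theta T) 0 = deg T (parent T 1)
        \<and> deg (theta T) (parent (theta T) 1) = deg T 0
        \<and> (\<forall>v \<in> {0..n} - {0, parent T 1}. deg (theta T) v = deg T v))
    \<and> (\<forall>k. card {T \<in> trees n. deg T 0 = k} = card {T \<in> trees n. deg T (parent T 1) = k})"
proof (intro conjI ballI allI)
  fix T assume T: "T \<in> trees n"
  then show "\<exists>!p. is_parent T p 1"
    using assms by (intro ex1_parent[of "{0..n}"]) (auto simp: trees_def)
  note th = theta_properties[OF assms T refl]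
  show "theta T \<in> trees n" "theta (theta T) = T" "deg (theta T) 0 = deg T (parent T 1)"
    using th by auto
  show "deg (theta T) (parent (theta T) 1) = deg T 0" using th(2,5) by simp
  show "deg (theta T) v = deg T v" if "v \<in> {0..n} - {0, parent T 1}" for v
    using th(6) that .
next
  fix k
  note th = theta_properties[OF assms _ refl]
  have "bij_betw theta {T \<in> trees n. deg T 0 = k} {T \<in> trees n. deg T (parent T 1) = k}"
    by (rule bij_betw_byWitness[where f' = theta]) (use th in auto)
  then show "card {T \<in> trees n. deg T 0 = k} = card {T \<in> trees n. deg T (parent T 1) = k}"
    by (rule bij_betw_same_card)
qed

end
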